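(* Let $M:(0,1)\to(0,1)$ be strictly increasing (it maps compliance to cost), $\epsilon\in(0,1)$ and $p_\epsilon:=M(\epsilon)$. Consider the Circa auction described in the context, where the total value $V_i$ and the scaling factor $\lambda_i$ both stem from a Uniform distribution ($V_i$ on $[0,1]$, $\lambda_i$ on $[0,1/2]$), with $v_i^d=(1-\lambda_i)V_i$ and $v_i^p=\lambda_iV_i$. Then the optimal (symmetric Nash equilibrium) bid of agents participating in the auction is $b_i^*:=\min\{\hat b_i^*,1\}$, where $$\hat b_i^*=\begin{cases}p_\epsilon+\dfrac{(v_i^p)^2\ln(p_\epsilon)}{p_\epsilon-1} & \text{if } 0\le v_i^p\le \frac{p_\epsilon}{2},\\[2mm] p_\epsilon+\dfrac{8(v_i^p)^2\bigl(\ln(2v_i^p)-\tfrac12\bigr)+p_\epsilon^2}{8(p_\epsilon-1)} & \text{if } \frac{p_\epsilon}{2}\le v_i^p\le\frac12 ,\end{cases}$$ that is, if every rival $j$ bids $b_j^*$ (given by the same formula in terms of $v_j^p$), then for every participating agent $i$ the bid $b_i^*$ maximizes its expected utility. The utility attained is $$u_i(b_i^*;\boldsymbol b_{-i},v_i^d,v_i^p)=\begin{cases}\dfrac{2(v_i^p)^2\ln(p_\epsilon)}{p_\epsilon-1}+v_i^d-b_i^* & \text{if } 0\le v_i^p\le\frac{p_\epsilon}{2},\\[2mm] \dfrac{2(v_i^p)^2\bigl(\ln(2v_i^p)-1\bigr)+v_i^p\,p_\epsilon}{p_\epsilon-1}+v_i^d-b_i^* & \text{if } \frac{p_\epsilon}{2}\le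 v_i^p\le\frac12 .\end{cases}$$ Participating agents submit models with compliance level $$s_i^*:=\begin{cases}M^{-1}(b_i^* )>\epsilon & \text{if } u_i(b_i^*;\boldsymbol b_{-i},v_i^d,v_i^p)>0,\\ 0\ \text{(no submission)} & \text{otherwise.}\end{cases}$$
   Context: Circa auction. A regulator fixes a compliance threshold $\epsilon\in(0,1)$. An agent spending (bidding) $b$ obtains a model of compliance level $M^{-1}(b)$; the price of the threshold is $p_\epsilon=M(\epsilon)\in(0,1)$. Each agent $i$ privately and independently draws $V_i$ and $\lambda_i$ (independent of each other) from the distributions in the claim, which are common knowledge; $v_i^d=(1-\lambda_i)V_i$ is its deployment value and $v_i^p=\lambda_iV_i\in[0,1/2]$ its premium value. Agent $i$ chooses a bid $b\in[0,1]$, which is a sunk cost. It is paired with one randomly chosen rival $j$ among participating agents. If $b_j$ is the rival's bid and $\boldsymbol b_{-i}$ denotes the bids of all agents other than $i$, agent $i$'s realized utility is $$u_i(b;\boldsymbol b_{-i},v_i^d,v_i^p)=\begin{cases}-b & \text{if } b<p_\epsilon,\\ v_i^d-b & \text{if } b\ge p_\epsilon \text{ and } b<b_j,\\ v_i^d+v_i^p-b & \text{if } b\ge p_\epsilon\text{ and } b>b_j,\end{cases}$$ and a bid $b=1$ automatically wins, i.e. yields $v_i^d+v_i^p-1$. "Utility" of a bid means the expectation of this quantity over the random participating rival and its private values, with agent $i$'s own $v_i^d,v_i^p$ fixed. Bidding $0$ means not participating (no submission, compliance recorded as $0$) and gives utility $0$. An agent participates exactly when some bid gives it strictly positive (expected)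 utility.
   Formalization: The rival is drawn from agents with V_j > p_ε (for the pool of agents with positive expected utility the formulas fail); s_i^* > ε is claimed only for v_i^p > 0 (at v_i^p = 0 it is s_i^* ≥ ε), and the compliance claim only where b_i^* is in the range of M. *)

theory Defs
  imports "HOL-Probability.Probability"
begin

text \<open>A type is a pair \<open>(V, \<lambda>)\<close> of total value and scaling factor.\<close>

definition type_space :: "(real \<times> real) set" where
  "type_space = {0..1} \<times> {0..1/2}"

definition type_law :: "(real \<times> real) measure" where
  "type_law = uniform_measure lborel {0..1} \<Otimes>\<^sub>M uniform_measure lborel {0..1/2}"

definition dep_value :: "real \<times> real \<Rightarrow> real" where
  "dep_value = (\<lambda>(V, l). (1 - l) * V)"

definition prem_value :: "real \<times> real \<Rightarrow> real" where
  "prem_value = (\<lambda>(V, l). l * V)"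

text \<open>Realized utility of the bid \<open>b\<close> against the rival bid \<open>bj\<close>. For \<open>p \<le> b = bj < 1\<close> the
  premium is shared: the agent gets the fraction \<open>\<tau>\<close> of it, for an arbitrary tie-breaking
  rule \<open>\<tau> \<in> [0, 1]\<close>. Since \<open>p > 0\<close>, bidding \<open>0\<close> yields \<open>0\<close>.\<close>

definition utility :: "real \<Rightarrow> real \<Rightarrow> real \<Rightarrow> real \<Rightarrow> real \<Rightarrow> real \<Rightarrow> real" where
  "utility \<tau> p b bj vd vp =
     (if b < p then - b
      else if b = 1 then vd + vp - 1
      else if b < bj then vd - b
      else if b > bj then vd + vp - b
      else vd + \<tau> * vp - b)"

text \<open>The pool from which the rival is drawn: the types for which taking part can pay off at
  all, i.e. for which some bid has positive realized utility against some rival bid. These are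
  the types with total value above the price \<open>p\<close> (lemma \<open>contenders_eq\<close>); conditioned on the
  pool, \<open>V\<close> is uniform on \<open>(p, 1]\<close>, and then \<open>\<lambda> V\<close> has distribution function
  \<open>2 z ln p / (p - 1)\<close> for \<open>0 \<le> z \<le> p/2\<close> and \<open>(2 z (ln (2 z) - 1) + p) / (p - 1)\<close> for
  \<open>p/2 \<le> z \<le> 1/2\<close>. The pool must not be confused with the smaller set \<open>participates\<close> below,
  which refers to expected utility: conditioning on that set gives a different law of
  \<open>\<lambda> V\<close>, for which the equilibrium bid is a different one.\<close>

definition contenders :: "real \<Rightarrow> real \<Rightarrow> (real \<times> real) set" where
  "contenders \<tau> p = {t \<in> type_space.
     \<exists>b\<in>{0..1}. \<exists>bj\<in>{0..1}. 0 < utility \<tau> p b bj (dep_value t) (prem_value t)}"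

text \<open>The type law conditioned on the pool.\<close>

definition rival_law :: "real \<Rightarrow> real \<Rightarrow> (real \<times> real) measure" where
  "rival_law \<tau> p = uniform_measure type_law (contenders \<tau> p)"

definition expected_utility ::
  "real \<Rightarrow> real \<Rightarrow> (real \<times> real \<Rightarrow> real) \<Rightarrow> real \<Rightarrow> real \<Rightarrow> real \<Rightarrow> real" where
  "expected_utility \<tau> p \<beta> vd vp b = (\<integral>t. utility \<tau> p b (\<beta> t) vd vp \<partial>rival_law \<tau> p)"

definition participates ::
  "real \<Rightarrow> real \<Rightarrow> (real \<times> real \<Rightarrow> real) \<Rightarrow> real \<times> real \<Rightarrow> bool" where
  "participates \<tau> p \<beta> t \<longleftrightarrow>
     (\<exists>b\<in>{0..1}. 0 < expected_utility \<tau> p \<beta> (dep_value t) (prem_value t) b)"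

text \<open>Measurability of the strategy makes all expected utilities proper integrals.\<close>

definition symmetric_equilibrium ::
  "real \<Rightarrow> real \<Rightarrow> (real \<times> real \<Rightarrow> real) \<Rightarrow> bool" where
  "symmetric_equilibrium \<tau> p \<beta> \<longleftrightarrow>
     \<beta> \<in> borel_measurable borel \<and>
     (\<forall>t\<in>type_space. participates \<tau> p \<beta> t \<longrightarrow>
        \<beta> t \<in> {0..1} \<and>
        (\<forall>b\<in>{0..1}. expected_utility \<tau> p \<beta> (dep_value t) (prem_value t) b
                  \<le> expected_utility \<tau> p \<beta> (dep_value t) (prem_value t) (\<beta> t)))"

definition raw_bid :: "real \<Rightarrow> real \<Rightarrow> real" where
  "raw_bid p v =
     (if v \<le> p / 2 then p + v\<^sup>2 * ln p / (p - 1)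
      else p + (8 * v\<^sup>2 * (ln (2 * v) - 1/2) + p\<^sup>2) / (8 * (p - 1)))"

definition opt_bid :: "real \<Rightarrow> real \<times> real \<Rightarrow> real" where
  "opt_bid p t = min (raw_bid p (prem_value t)) 1"

definition opt_utility :: "real \<Rightarrow> real \<times> real \<Rightarrow> real" where
  "opt_utility p t = (let vd = dep_value t; vp = prem_value t in
     (if vp \<le> p / 2 then 2 * vp\<^sup>2 * ln p / (p - 1) + vd - opt_bid p t
      else (2 * vp\<^sup>2 * (ln (2 * vp) - 1) + vp * p) / (p - 1) + vd - opt_bid p t))"

text \<open>Compliance level of the submitted model, \<open>0\<close> for no submission. The inverse of \<open>M\<close> is
  only meaningful at bids in the range of \<open>M\<close>.\<close>

definition compliance ::
  "(real \<Rightarrow> real) \<Rightarrow> real \<Rightarrow> real \<Rightarrow> (real \<times> real \<Rightarrow> real) \<Rightarrow> real \<times> real \<Rightarrow> real" where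
  "compliance M \<tau> p \<beta> t =
     (if 0 < expected_utility \<tau> p \<beta> (dep_value t) (prem_value t) (\<beta> t)
      then the_inv_into {0<..<1} M (\<beta> t) else 0)"

lemma contenders_eq:
  assumes "0 < p" "p < 1" "0 \<le> \<tau>" "\<tau> \<le> 1"
  shows "contenders \<tau> p = {p<..1} \<times> {0..1/2}"
proof -
  have "(\<exists>b\<in>{0..1}. \<exists>bj\<in>{0..1}. 0 < utility \<tau> p b bj ((1 - l) * V) (l * V)) \<longleftrightarrow> p < V"
    if V: "0 \<le> V" "V \<le> 1" and l: "0 \<le> l" "l \<le> 1/2" for V l :: real
  proof
    assume "\<exists>b\<in>{0..1}. \<exists>bj\<in>{0..1}. 0 < utility \<tau> p b bj ((1 - l) * V) (l * V)"
    then obtain b bj where b: "0 \<le> b" "b \<le> 1" "0 < utility \<tau> p b bj ((1 - l) * V) (l * V)"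
      by auto
    have lV: "0 \<le> l * V" using V l by simp
    have "\<tau> * (l * V) \<le> l * V" using assms lV by (simp add: mult_left_le_one_le)
    then show "p < V"
      using b V lV assms by (auto simp: utility_def algebra_simps split: if_splits)
  next
    assume "p < V"
    then have "0 < utility \<tau> p p 0 ((1 - l) * V) (l * V)"
      using assms by (simp add: utility_def algebra_simps)
    then show "\<exists>b\<in>{0..1}. \<exists>bj\<in>{0..1}. 0 < utility \<tau> p b bj ((1 - l) * V) (l * V)"
      using assms by (intro bexI[of _ p] bexI[of _ 0]) auto
  qed
  then have "t \<in> contenders \<tau> p \<longleftrightarrow> t \<in> {p<..1} \<times> {0..1/2}" for t
    using assms(1) by (cases t)
      (simp add: contenders_def type_space_def dep_value_def prem_value_def cong: conj_cong, linarith)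
  then show ?thesis by blast
qed

lemma prob_space_rival_law:
  assumes "0 < p" "p < 1" "0 \<le> \<tau>" "\<tau> \<le> 1"
  shows "prob_space (rival_law \<tau> p)"
proof -
  let ?V = "uniform_measure lborel {0..1::real}" and ?L = "uniform_measure lborel {0..1/2::real}"
  interpret V: prob_space ?V by (rule prob_space_uniform_measure) auto
  interpret L: prob_space ?L by (rule prob_space_uniform_measure) auto
  interpret VL: pair_prob_space ?V ?L ..
  have "emeasure type_law (contenders \<tau> p) = emeasure ?V {p<..1} * emeasure ?L {0..1/2}"
    unfolding type_law_def contenders_eq[OF assms]
    by (rule L.emeasure_pair_measure_Times) auto
  moreover have "emeasure ?V {p<..1} \<noteq> 0"
    using assms by (simp add: emeasure_uniform_measure Int_absorb1 subset_eq ennreal_zero_divide)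
  moreover have "emeasure ?L {0..1/2} \<noteq> 0"
    by (simp add: emeasure_uniform_measure ennreal_divide_self)
  ultimately have "emeasure type_law (contenders \<tau> p) \<noteq> 0" by simp
  moreover have "emeasure type_law (contenders \<tau> p) \<noteq> \<infinity>"
    unfolding type_law_def by (simp add: VL.P.emeasure_finite)
  ultimately show ?thesis
    unfolding rival_law_def by (rule prob_space_uniform_measure)
qed

end

theory Submission
  imports Defs
begin

text \<open>Conditioned on \<open>p < V\<close>, the premium value \<open>Z = \<lambda> V\<close> has a continuous distribution
  function \<open>F\<close> with density \<open>f\<close>, and the raw bid is
  \<open>R v = p + \<integral>\<^sub>0\<^sup>v z f z dz\<close>. As \<open>R\<close> is strictly increasing, the bid \<open>R z < 1\<close> beats exactly the
  rivals with \<open>Z < z\<close>, so an agent with premium value \<open>v\<close> gets \<open>v\<^sup>d + v F z - R z\<close> from it. The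
  derivative \<open>(v - z) f z\<close> of this payoff changes sign at \<open>z = v\<close>. If the cap binds, that is
  \<open>R v \<ge> 1\<close>, the same monotonicity bounds every bid's utility by the total value minus \<open>1\<close>,
  hence by \<open>0\<close>, and the agent stays out; so the cap is never active for participants.\<close>

section \<open>Closed forms on the two ranges of the premium value\<close>

definition prem_cdf :: "real \<Rightarrow> real \<Rightarrow> real" where
  "prem_cdf p z =
     (if z \<le> p / 2 then 2 * z * ln p / (p - 1) else (2 * z * (ln (2 * z) - 1) + p) / (p - 1))"

lemma prem_cdf_low: "z \<le> p / 2 \<Longrightarrow> prem_cdf p z = 2 * z * ln p / (p - 1)"
  by (simp add: prem_cdf_def)

text \<open>At \<open>z = p / 2\<close> one has \<open>ln (2 * z) = ln p\<close>, and the two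
  branches agree. The second formula thus holds on a closed interval, as it does for the raw bid
  below, which allows calculus on each piece and gluing at \<open>p / 2\<close>.\<close>

lemma prem_cdf_high:
  assumes "p / 2 \<le> z"
  shows "prem_cdf p z = (2 * z * (ln (2 * z) - 1) + p) / (p - 1)"
  using assms by (cases "z = p / 2") (auto simp: prem_cdf_def algebra_simps)

lemma raw_bid_low: "z \<le> p / 2 \<Longrightarrow> raw_bid p z = p + z\<^sup>2 * ln p / (p - 1)"
  by (simp add: raw_bid_def)

lemma raw_bid_high:
  assumes "p / 2 \<le> z"
  shows "raw_bid p z = p + (8 * z\<^sup>2 * (ln (2 * z) - 1/2) + p\<^sup>2) / (8 * (p - 1))"
proof (cases "z = p / 2")
  case True
  have "(8 * z\<^sup>2 * (ln (2 * z) - 1/2) + p\<^sup>2) / (8 * (p - 1)) = (8 * (z\<^sup>2 * ln p)) / (8 * (p - 1))"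
    unfolding True by (simp add: power2_eq_square algebra_simps)
  also have "\<dots> = z\<^sup>2 * ln p / (p - 1)"
    by (rule mult_divide_mult_cancel_left) simp
  finally show ?thesis
    by (simp add: raw_bid_def True)
qed (use assms in \<open>simp add: raw_bid_def\<close>)

section \<open>Monotonicity and range of the raw bid\<close>

context
  fixes p :: real
  assumes p: "0 < p" "p < 1"
begin

lemma DERIV_prem_cdf_high:
  assumes "0 < z"
  shows "((\<lambda>z. (2 * z * (ln (2 * z) - 1) + p) / (p - 1))
          has_real_derivative (2 * ln (2 * z) / (p - 1))) (at z)"
  using assms p by (auto intro!: derivative_eq_intros simp: divide_simps)

text \<open>The derivative is \<open>z\<close> times the density from
  \<open>DERIV_prem_cdf_high\<close>. This is the first-order condition of the equilibrium: the
  marginal cost of a higher bid equals the marginal gain of an agent whose premium value is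
  \<open>z\<close>.\<close>

lemma DERIV_raw_bid_high:
  assumes "0 < z"
  shows "((\<lambda>z. p + (8 * z\<^sup>2 * (ln (2 * z) - 1/2) + p\<^sup>2) / (8 * (p - 1)))
          has_real_derivative (z * (2 * ln (2 * z) / (p - 1)))) (at z)"
  using assms p
  by (auto intro!: derivative_eq_intros simp: divide_simps power2_eq_square) (auto simp: algebra_simps)

lemma raw_bid_strict_mono_low:
  assumes "0 \<le> w" "w < z" "z \<le> p / 2"
  shows "raw_bid p w < raw_bid p z"
proof -
  have "0 < ln p / (p - 1)"
    using p by (simp add: zero_less_divide_iff)
  moreover have "w\<^sup>2 < z\<^sup>2"
    using assms by (simp add: power_strict_mono)
  ultimately have "w\<^sup>2 * (ln p / (p - 1)) < z\<^sup>2 * (ln p / (p - 1))"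
    by (rule mult_strict_right_mono[rotated])
  then show ?thesis
    using assms by (simp add: raw_bid_low)
qed

lemma raw_bid_strict_mono_high:
  assumes "p / 2 \<le> w" "w < z" "z \<le> 1 / 2"
  shows "raw_bid p w < raw_bid p z"
proof -
  let ?R = "\<lambda>z. p + (8 * z\<^sup>2 * (ln (2 * z) - 1/2) + p\<^sup>2) / (8 * (p - 1))"
  have d: "(?R has_real_derivative (u * (2 * ln (2 * u) / (p - 1)))) (at u)" if "0 < u" for u
    using DERIV_raw_bid_high[OF that] .
  \<comment> \<open>The derivative vanishes at \<open>1 / 2\<close>, where
    \<open>ln (2 * u) = 0\<close>. Positivity is therefore asked only in the open interval, together
    with continuity on the closed one.\<close>
  have "?R w < ?R z"
  proof (rule DERIV_pos_imp_increasing_open[OF \<open>w < z\<close>])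
    fix u assume u: "w < u" "u < z"
    then have "0 < u" "u < 1 / 2" using assms p by auto
    then have "0 < u * (2 * ln (2 * u) / (p - 1))"
      using p by (intro mult_pos_pos divide_neg_neg) auto
    then show "\<exists>y. DERIV ?R u :> y \<and> y > 0"
      using d[OF \<open>0 < u\<close>] by blast
  next
    show "continuous_on {w..z} ?R"
      using assms p d by (intro DERIV_continuous_on[where D="\<lambda>u. u * (2 * ln (2 * u) / (p - 1))"])
        (auto intro: has_field_derivative_at_within)
  qed
  then show ?thesis using assms by (simp add: raw_bid_high)
qed

lemma raw_bid_strict_mono:
  assumes "0 \<le> w" "w < z" "z \<le> 1 / 2"
  shows "raw_bid p w < raw_bid p z"
proof -
  consider "z \<le> p / 2" | "p / 2 \<le> w" | "w < p / 2" "p / 2 < z" by linarith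
  then show ?thesis
  proof cases
    case 3
    then show ?thesis
      using raw_bid_strict_mono_low[of w "p / 2"] raw_bid_strict_mono_high[of "p / 2" z] assms by simp
  qed (use assms raw_bid_strict_mono_low raw_bid_strict_mono_high in auto)
qed

lemma raw_bid_less_iff:
  assumes "w \<in> {0..1/2}" "z \<in> {0..1/2}"
  shows "raw_bid p w < raw_bid p z \<longleftrightarrow> w < z"
  using assms raw_bid_strict_mono[of w z] raw_bid_strict_mono[of z w]
  by (cases w z rule: linorder_cases) auto

lemma raw_bid_0 [simp]: "raw_bid p 0 = p"
  using p by (simp add: raw_bid_def)

lemma raw_bid_ge:
  assumes "z \<in> {0..1/2}"
  shows "p \<le> raw_bid p z"
  using raw_bid_less_iff[of z 0] assms by (auto simp: not_less[symmetric])

text \<open>The intermediate value theorem on the branch that contains \<open>b\<close>. A deviation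
  to \<open>b\<close> can then be treated as imitating an agent with premium value
  \<open>z\<close>.\<close>

lemma raw_bid_attains:
  assumes "p \<le> b" "b \<le> raw_bid p (1/2)"
  obtains z where "z \<in> {0..1/2}" "raw_bid p z = b"
proof (cases "b \<le> raw_bid p (p / 2)")
  case True
  let ?R = "\<lambda>z. p + z\<^sup>2 * ln p / (p - 1)"
  have "\<exists>z\<ge>0. z \<le> p / 2 \<and> ?R z = b"
    using assms True p by (intro IVT') (auto simp: raw_bid_low intro!: continuous_intros)
  then show ?thesis
    using p that by (force simp: raw_bid_low)
next
  case False
  let ?R = "\<lambda>z. p + (8 * z\<^sup>2 * (ln (2 * z) - 1/2) + p\<^sup>2) / (8 * (p - 1))"
  have "\<exists>z\<ge>p / 2. z \<le> 1 / 2 \<and> ?R z = b"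
    using assms False p raw_bid_high[of p "p / 2"] raw_bid_high[of p "1/2"]
    by (intro IVT') (auto intro!: continuous_intros)
  then obtain z where "p / 2 \<le> z" "z \<le> 1 / 2" "?R z = b" by blast
  then show ?thesis
    using p raw_bid_high[of p z] by (intro that[of z]) auto
qed

section \<open>Single-peakedness of the payoff in the imitated premium value\<close>

text \<open>On this range the density is a constant \<open>2 * c\<close>, so the payoff is a
  downward parabola with vertex \<open>v\<close>: being closer to \<open>v\<close> is better, on
  either side.\<close>

lemma payoff_mono_low:
  assumes "w \<le> p / 2" "z \<le> p / 2" "\<bar>z - v\<bar> \<le> \<bar>w - v\<bar>"
  shows "v * prem_cdf p w - raw_bid p w \<le> v * prem_cdf p z - raw_bid p z"
proof -
  define c where "c = ln p / (p - 1)"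
  have "0 \<le> c" using p by (simp add: c_def zero_le_divide_iff)
  moreover have "(z - v)\<^sup>2 \<le> (w - v)\<^sup>2"
    using assms(3) by (simp add: abs_le_square_iff)
  ultimately have "c * (z - v)\<^sup>2 \<le> c * (w - v)\<^sup>2"
    by (intro mult_left_mono)
  moreover have "v * prem_cdf p u - raw_bid p u = c * v\<^sup>2 - p - c * (u - v)\<^sup>2" if "u \<le> p / 2" for u
  proof -
    have "prem_cdf p u = 2 * u * c" "raw_bid p u = p + u\<^sup>2 * c"
      using that by (simp_all add: c_def prem_cdf_low raw_bid_low)
    then show ?thesis
      by (simp add: power2_eq_square algebra_simps)
  qed
  ultimately show ?thesis using assms by simp
qed

text \<open>The payoff has derivative \<open>v - u\<close> times a nonnegative density, so moving
  towards \<open>v\<close> never hurts.\<close>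

lemma payoff_mono_high:
  assumes "w \<in> {p/2..1/2}" "z \<in> {p/2..1/2}" "w \<le> z \<and> z \<le> v \<or> v \<le> z \<and> z \<le> w"
  shows "v * prem_cdf p w - raw_bid p w \<le> v * prem_cdf p z - raw_bid p z"
proof -
  let ?G = "\<lambda>z. v * ((2 * z * (ln (2 * z) - 1) + p) / (p - 1))
            - (p + (8 * z\<^sup>2 * (ln (2 * z) - 1/2) + p\<^sup>2) / (8 * (p - 1)))"
  have d: "(?G has_real_derivative (v - u) * (2 * ln (2 * u) / (p - 1))) (at u)"
    if "0 < u" for u
    using DERIV_diff[OF DERIV_cmult[OF DERIV_prem_cdf_high[OF that], of v] DERIV_raw_bid_high[OF that]]
    by (simp only: left_diff_distrib)
  have f: "0 \<le> 2 * ln (2 * u) / (p - 1)" if "u \<in> {p/2..1/2}" for u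
    using that p by (auto intro!: divide_nonpos_neg)
  have "?G w \<le> ?G z"
    using assms(3)
  proof
    assume *: "w \<le> z \<and> z \<le> v"
    show "?G w \<le> ?G z"
    proof (rule DERIV_nonneg_imp_nondecreasing[where f="?G"])
      fix u assume "w \<le> u" "u \<le> z"
      then show "\<exists>y. DERIV ?G u :> y \<and> 0 \<le> y"
        using * assms p d[of u] f[of u]
        by (intro exI[of _ "(v - u) * (2 * ln (2 * u) / (p - 1))"] conjI mult_nonneg_nonneg) auto
    qed (use * in simp)
  next
    assume *: "v \<le> z \<and> z \<le> w"
    show "?G w \<le> ?G z"
    proof (rule DERIV_nonpos_imp_nonincreasing[where f="?G"])
      fix u assume "z \<le> u" "u \<le> w"
      then show "\<exists>y. DERIV ?G u :> y \<and> y \<le> 0"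
        using * assms p d[of u] f[of u]
        by (intro exI[of _ "(v - u) * (2 * ln (2 * u) / (p - 1))"] conjI mult_nonpos_nonneg) auto
    qed (use * in simp)
  qed
  then show ?thesis using assms by (simp add: prem_cdf_high raw_bid_high)
qed

lemma payoff_mono:
  assumes "w \<in> {0..1/2}" "z \<in> {0..1/2}" "w \<le> z \<and> z \<le> v \<or> v \<le> z \<and> z \<le> w"
  shows "v * prem_cdf p w - raw_bid p w \<le> v * prem_cdf p z - raw_bid p z"
proof -
  consider "w \<le> p/2 \<and> z \<le> p/2" | "p/2 \<le> w \<and> p/2 \<le> z"
    | "w < p/2" "p/2 < z" | "z < p/2" "p/2 < w" by linarith
  then show ?thesis
  proof cases
    case 1
    then show ?thesis using assms by (intro payoff_mono_low) auto
  next
    case 2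
    then show ?thesis using assms by (intro payoff_mono_high) auto
  next
    \<comment> \<open>Here and in the mirrored case \<open>p/2\<close> lies between \<open>w\<close>
      and \<open>z\<close>, which are on the same side of \<open>v\<close>; both legs of the detour
      through \<open>p/2\<close> therefore move towards \<open>v\<close>.\<close>
    case 3
    have "v * prem_cdf p w - raw_bid p w \<le> v * prem_cdf p (p/2) - raw_bid p (p/2)"
      using 3 assms p by (intro payoff_mono_low) auto
    also have "\<dots> \<le> v * prem_cdf p z - raw_bid p z"
      using 3 assms p by (intro payoff_mono_high) auto
    finally show ?thesis .
  next
    case 4
    have "v * prem_cdf p w - raw_bid p w \<le> v * prem_cdf p (p/2) - raw_bid p (p/2)"
      using 4 assms p by (intro payoff_mono_high) auto
    also have "\<dots> \<le> v * prem_cdf p z - raw_bid p z"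
      using 4 assms p by (intro payoff_mono_low) auto
    finally show ?thesis .
  qed
qed

section \<open>Distribution of the rival's premium value\<close>

text \<open>For fixed \<open>V > 0\<close>, the event \<lambda> V \<le> z has probability
  \<open>min 1 (2 * z / V)\<close>, as \<lambda> is uniform on [0, 1/2]. Integrating over
  \<open>V\<close> gives the distribution function times the mass \<open>1 - p\<close> of the
  pool.\<close>

lemma has_integral_section_length:
  assumes "z \<in> {0..1/2}"
  shows "((\<lambda>V. min 1 (2 * z / V)) has_integral ((1 - p) * prem_cdf p z)) {p..1}"
proof (cases "z \<le> p / 2")
  case True
  have "((\<lambda>V. 2 * z / V) has_integral (2 * z * ln 1 - 2 * z * ln p)) {p..1}"
    using p by (intro fundamental_theorem_of_calculus)
      (auto intro!: derivative_eq_intros simp flip: has_real_derivative_iff_has_vector_derivative)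
  then have "((\<lambda>V. min 1 (2 * z / V)) has_integral (2 * z * ln 1 - 2 * z * ln p)) {p..1}"
    by (rule has_integral_eq[rotated]) (use p True in auto)
  moreover have "2 * z * ln 1 - 2 * z * ln p = (1 - p) * prem_cdf p z"
    using True p by (simp add: prem_cdf_low field_simps)
  ultimately show ?thesis by simp
next
  case False
  \<comment> \<open>The minimum equals 1 exactly up to \<open>V = 2 * z\<close>, which now exceeds
    \<open>p\<close>; the integral is split there.\<close>
  have "((\<lambda>V. 1::real) has_integral (2 * z - p)) {p..2*z}"
    using has_integral_const_real[of "1::real" p "2*z"] False by simp
  then have 1: "((\<lambda>V. min 1 (2 * z / V)) has_integral (2 * z - p)) {p..2*z}"
    by (rule has_integral_eq[rotated]) (use p False in auto)
  have "((\<lambda>V. 2 * z / V) has_integral (2 * z * ln 1 - 2 * z * ln (2 * z))) {2*z..1}"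
    using p False assms by (intro fundamental_theorem_of_calculus)
      (auto intro!: derivative_eq_intros simp flip: has_real_derivative_iff_has_vector_derivative)
  then have 2: "((\<lambda>V. min 1 (2 * z / V)) has_integral (2 * z * ln 1 - 2 * z * ln (2 * z))) {2*z..1}"
    by (rule has_integral_eq[rotated]) (use p False in auto)
  have "((\<lambda>V. min 1 (2 * z / V)) has_integral
      (2 * z - p + (2 * z * ln 1 - 2 * z * ln (2 * z)))) {p..1}"
    using False assms by (intro has_integral_combine[OF _ _ 1 2]) auto
  moreover have "2 * z - p + (2 * z * ln 1 - 2 * z * ln (2 * z)) = (1 - p) * prem_cdf p z"
    using False p by (simp add: prem_cdf_high divide_simps) (simp add: algebra_simps)
  ultimately show ?thesis by simp
qed

end

lemma type_space_values:
  assumes "t \<in> type_space"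
  shows "prem_value t \<in> {0..1/2}" "dep_value t + prem_value t \<le> 1"
proof -
  obtain V l where t: "t = (V, l)" "0 \<le> V" "V \<le> 1" "0 \<le> l" "l \<le> 1/2"
    using assms by (auto simp: type_space_def)
  then show "prem_value t \<in> {0..1/2}"
    using mult_mono[of l "1/2" V 1] by (auto simp: prem_value_def)
  show "dep_value t + prem_value t \<le> 1"
    using t by (simp add: prem_value_def dep_value_def algebra_simps)
qed

context
  fixes p \<tau> :: real
  assumes p: "0 < p" "p < 1" and \<tau>: "0 \<le> \<tau>" "\<tau> \<le> 1"
begin

abbreviation "V_law \<equiv> uniform_measure lborel {0..1::real}"
abbreviation "l_law \<equiv> uniform_measure lborel {0..1/2::real}"

lemma prem_value_measurable [measurable]: "prem_value \<in> borel_measurable borel"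
  unfolding prem_value_def borel_prod[symmetric] by measurable

lemma opt_bid_measurable [measurable]: "opt_bid q \<in> borel_measurable borel"
  unfolding opt_bid_def raw_bid_def by measurable

lemma sets_type_law [measurable_cong]: "sets type_law = sets borel"
  unfolding type_law_def borel_prod[symmetric] by (rule sets_pair_measure_cong) auto

lemma sets_rival_law [measurable_cong]: "sets (rival_law \<tau> p) = sets borel"
  by (simp add: rival_law_def sets_type_law)

lemma space_rival_law [simp]: "space (rival_law \<tau> p) = UNIV"
  using sets_eq_imp_space_eq[OF sets_rival_law] by simp

lemma contenders_in_sets [measurable]: "contenders \<tau> p \<in> sets borel"
  unfolding contenders_eq[OF p \<tau>] borel_prod[symmetric] by (rule pair_measureI) auto

lemma emeasure_l_law:
  assumes "A \<in> sets borel"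
  shows "emeasure l_law A = 2 * emeasure lborel ({0..1/2} \<inter> A)"
proof -
  have "emeasure l_law A = emeasure lborel ({0..1/2} \<inter> A) / ennreal (1/2)"
    using assms by (subst emeasure_uniform_measure) auto
  also have "\<dots> = 2 * emeasure lborel ({0..1/2} \<inter> A)"
    unfolding divide_ennreal_def by (subst inverse_ennreal) (auto simp: mult.commute)
  finally show ?thesis .
qed

text \<open>Fubini with the inner integral over \<lambda>. The slice mass \<open>f\<close> is left
  open to serve the whole pool, the sublevel sets and the level sets of the premium value.\<close>

lemma emeasure_type_law:
  assumes A: "A \<in> sets borel" and f: "\<And>V. V \<in> {p<..1} \<Longrightarrow> emeasure l_law (Pair V -` A \<inter> {0..1/2}) = f V"
  shows "emeasure type_law (contenders \<tau> p \<inter> A) = (\<integral>\<^sup>+V. f V * indicator {p..1} V \<partial>lborel)"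
proof -
  interpret L: prob_space l_law by (rule prob_space_uniform_measure) auto
  have sets: "contenders \<tau> p \<inter> A \<in> sets (V_law \<Otimes>\<^sub>M l_law)"
    using A sets_type_law by (auto simp: type_law_def)
  have "sets (lborel \<Otimes>\<^sub>M l_law) = sets (V_law \<Otimes>\<^sub>M l_law)"
    by (rule sets_pair_measure_cong) auto
  with sets have meas: "(\<lambda>V. emeasure l_law (Pair V -` (contenders \<tau> p \<inter> A))) \<in> borel_measurable lborel"
    by (intro L.measurable_emeasure_Pair) simp
  have "emeasure type_law (contenders \<tau> p \<inter> A)
      = (\<integral>\<^sup>+V. emeasure l_law (Pair V -` (contenders \<tau> p \<inter> A)) \<partial>V_law)"
    unfolding type_law_def by (rule L.emeasure_pair_measure_alt[OF sets])
  also have "\<dots> = (\<integral>\<^sup>+V. emeasure l_law (Pair V -` (contenders \<tau> p \<inter> A)) * indicator {0..1} V \<partial>lborel)"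
    by (subst nn_integral_uniform_measure[OF meas]) (auto simp: divide_ennreal_def)
  \<comment> \<open>The pool excludes \<open>V = p\<close>, but a single point is null, so the
    integral may run over the closed interval.\<close>
  also have "\<dots> = (\<integral>\<^sup>+V. f V * indicator {p..1} V \<partial>lborel)"
  proof (rule nn_integral_cong_AE, use AE_lborel_singleton[of p] in eventually_elim)
    case (elim V)
    show ?case
    proof (cases "V \<in> {p<..1}")
      case True
      then have "Pair V -` (contenders \<tau> p \<inter> A) = Pair V -` A \<inter> {0..1/2}"
        by (auto simp: contenders_eq[OF p \<tau>])
      then show ?thesis using True p by (simp add: f)
    next
      case False
      then have "Pair V -` (contenders \<tau> p \<inter> A) = {}"
        by (auto simp: contenders_eq[OF p \<tau>])
      then show ?thesis using False elim by (auto simp: indicator_def)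
    qed
  qed
  finally show ?thesis .
qed

lemma emeasure_contenders: "emeasure type_law (contenders \<tau> p) = ennreal (1 - p)"
proof -
  have "emeasure l_law {0..1/2} = 1"
    by (rule emeasure_uniform_measure_1) auto
  then have "emeasure type_law (contenders \<tau> p \<inter> UNIV) = (\<integral>\<^sup>+V. 1 * indicator {p..1} V \<partial>lborel)"
    by (intro emeasure_type_law) auto
  then show ?thesis using p by simp
qed

lemma measure_prem_value_le:
  assumes z: "z \<in> {0..1/2}"
  shows "measure (rival_law \<tau> p) {t. prem_value t \<le> z} = prem_cdf p z"
proof -
  have F: "0 \<le> (1 - p) * prem_cdf p z"
    using has_integral_section_length[OF p z] by (rule has_integral_nonneg) (use p z in auto)
  have "emeasure type_law (contenders \<tau> p \<inter> {t. prem_value t \<le> z})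
      = (\<integral>\<^sup>+V. ennreal (min 1 (2 * z / V)) * indicator {p..1} V \<partial>lborel)"
  proof (rule emeasure_type_law)
    fix V assume V: "V \<in> {p<..1}"
    have "{0..1/2} \<inter> (Pair V -` {t. prem_value t \<le> z} \<inter> {0..1/2}) = {0..min (1/2) (z / V)}"
      using V p by (auto simp: prem_value_def field_simps)
    then have "emeasure l_law (Pair V -` {t. prem_value t \<le> z} \<inter> {0..1/2})
        = 2 * ennreal (min (1/2) (z / V))"
      using V p z by (subst emeasure_l_law) auto
    also have "\<dots> = ennreal (2 * min (1/2) (z / V))"
      by (simp add: ennreal_mult')
    also have "2 * min (1/2) (z / V) = min 1 (2 * z / V)"
      by (auto simp: min_def mult.commute)
    finally show "emeasure l_law (Pair V -` {t. prem_value t \<le> z} \<inter> {0..1/2})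
        = ennreal (min 1 (2 * z / V))" .
  qed measurable
  also have "\<dots> = ennreal ((1 - p) * prem_cdf p z)"
    by (rule nn_integral_has_integral_lebesgue'[OF _ has_integral_section_length[OF p z]])
      (use p z in auto)
  finally have "measure type_law (contenders \<tau> p \<inter> {t. prem_value t \<le> z}) = (1 - p) * prem_cdf p z"
    using F by (simp add: measure_def)
  then show ?thesis
    unfolding rival_law_def using p
    by (subst measure_uniform_measure)
      (auto simp: emeasure_contenders measure_def[of type_law "contenders \<tau> p"] sets_type_law)
qed

text \<open>For \<open>V > p\<close> the slice contains at most the point \<open>z / V\<close>.
  Hence a tie at a bid below the cap has probability zero.\<close>

lemma AE_prem_value_neq: "AE t in rival_law \<tau> p. prem_value t \<noteq> z"
proof -
  have "emeasure type_law (contenders \<tau> p \<inter> {t. prem_value t = z})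
      = (\<integral>\<^sup>+V. 0 * indicator {p..1} V \<partial>lborel)"
  proof (rule emeasure_type_law)
    fix V assume V: "V \<in> {p<..1}"
    have "Pair V -` {t. prem_value t = z} \<inter> {0..1/2} \<subseteq> {z / V}"
      using V p by (auto simp: prem_value_def field_simps)
    then have "countable (Pair V -` {t. prem_value t = z} \<inter> {0..1/2})"
      by (rule countable_subset) auto
    then show "emeasure l_law (Pair V -` {t. prem_value t = z} \<inter> {0..1/2}) = 0"
      by (simp add: emeasure_l_law emeasure_lborel_countable Int_absorb1 countable_imp_null_set_lborel)
  qed measurable
  then have "contenders \<tau> p \<inter> {t. prem_value t = z} \<in> null_sets type_law"
    by (intro null_setsI) (auto simp: sets_type_law)
  from AE_not_in[OF this] have "AE t in type_law. t \<in> contenders \<tau> p \<longrightarrow> prem_value t \<noteq> z"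
    by eventually_elim auto
  then show ?thesis
    unfolding rival_law_def by (intro AE_uniform_measureI) (auto simp: sets_type_law)
qed

lemma AE_prem_value_range: "AE t in rival_law \<tau> p. prem_value t \<in> {0..1/2}"
  unfolding rival_law_def
proof (intro AE_uniform_measureI AE_I2 impI)
  fix t assume "t \<in> contenders \<tau> p"
  then show "prem_value t \<in> {0..1/2}"
    by (intro type_space_values) (simp add: contenders_def)
qed (auto simp: sets_type_law)

section \<open>Expected utility of each kind of bid\<close>

text \<open>Covers the bids whose outcome is almost surely the same against every rival: those below
  \<open>p\<close>, the bid 1, and those above all rival bids.\<close>

lemma expected_utility_const:
  assumes "AE t in rival_law \<tau> p. utility \<tau> p b (\<beta> t) vd vp = c"
    and "\<beta> \<in> borel_measurable borel"
  shows "expected_utility \<tau> p \<beta> vd vp b = c"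
proof -
  interpret prob_space "rival_law \<tau> p" by (rule prob_space_rival_law[OF p \<tau>])
  note assms(2)[measurable]
  have "expected_utility \<tau> p \<beta> vd vp b = (\<integral>t. c \<partial>rival_law \<tau> p)"
    unfolding expected_utility_def
    by (rule integral_cong_AE) (use assms(1) in \<open>unfold utility_def, measurable\<close>)
  then show ?thesis using prob_space by simp
qed

lemma expected_utility_below:
  "b < p \<Longrightarrow> expected_utility \<tau> p (opt_bid p) vd vp b = - b"
  by (rule expected_utility_const) (auto simp: utility_def)

lemma expected_utility_1:
  "expected_utility \<tau> p (opt_bid p) vd vp 1 = vd + vp - 1"
  using p by (intro expected_utility_const) (auto simp: utility_def)

lemma expected_utility_above:
  assumes "raw_bid p (1/2) < b" "b < 1"
  shows "expected_utility \<tau> p (opt_bid p) vd vp b = vd + vp - b"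
proof (rule expected_utility_const)
  have "p < b" using assms raw_bid_ge[OF p, of "1/2"] by simp
  show "AE t in rival_law \<tau> p. utility \<tau> p b (opt_bid p t) vd vp = vd + vp - b"
    using AE_prem_value_range
  proof eventually_elim
    case (elim t)
    then have "raw_bid p (prem_value t) \<le> raw_bid p (1/2)"
      using raw_bid_less_iff[OF p, of "1/2" "prem_value t"] by auto
    then show ?case
      using assms \<open>p < b\<close> by (auto simp: utility_def opt_bid_def)
  qed
qed measurable

text \<open>A bid below 1 compares with a capped rival bid as with the raw one, and by strict
  monotonicity it wins exactly against smaller premium values. Replacing \<open><\<close> by
  \<open>\<le>\<close> in the indicator changes only a null set.\<close>

lemma expected_utility_raw_bid:
  assumes z: "z \<in> {0..1/2}" and "raw_bid p z < 1"
  shows "expected_utility \<tau> p (opt_bid p) vd vp (raw_bid p z)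
    = vd + vp * prem_cdf p z - raw_bid p z"
proof -
  interpret prob_space "rival_law \<tau> p" by (rule prob_space_rival_law[OF p \<tau>])
  let ?I = "\<lambda>t. vd - raw_bid p z + vp * indicator {t. prem_value t \<le> z} t"
  have "expected_utility \<tau> p (opt_bid p) vd vp (raw_bid p z) = (\<integral>t. ?I t \<partial>rival_law \<tau> p)"
    unfolding expected_utility_def
  proof (rule integral_cong_AE)
    show "AE t in rival_law \<tau> p. utility \<tau> p (raw_bid p z) (opt_bid p t) vd vp = ?I t"
      using AE_prem_value_range AE_prem_value_neq[of z]
    proof eventually_elim
      case (elim t)
      have "p \<le> raw_bid p z" using raw_bid_ge[OF p z] .
      then show ?case
        using elim assms raw_bid_less_iff[OF p elim(1) z] raw_bid_less_iff[OF p z elim(1)]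
        by (auto simp: utility_def opt_bid_def)
    qed
  next
    show "(\<lambda>t. utility \<tau> p (raw_bid p z) (opt_bid p t) vd vp) \<in> borel_measurable (rival_law \<tau> p)"
      unfolding utility_def by measurable
  qed measurable
  moreover have "integrable (rival_law \<tau> p) (indicator {t. prem_value t \<le> z} :: _ \<Rightarrow> real)"
    by (rule integrable_real_indicator) (auto simp: less_top[symmetric] emeasure_finite)
  then have "(\<integral>t. ?I t \<partial>rival_law \<tau> p) = vd - raw_bid p z + vp * measure (rival_law \<tau> p) {t. prem_value t \<le> z}"
    using prob_space by (subst Bochner_Integration.integral_add) auto
  ultimately show ?thesis
    by (simp add: measure_prem_value_le[OF z])
qed

lemma expected_utility_le_raw_bid:
  assumes "z \<in> {0..1/2}" "v \<in> {0..1/2}" "raw_bid p z < 1" "raw_bid p v < 1"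
  shows "expected_utility \<tau> p (opt_bid p) vd v (raw_bid p z)
    \<le> expected_utility \<tau> p (opt_bid p) vd v (raw_bid p v)"
  using payoff_mono[OF p assms(1,2), of v] linorder_linear[of z v] assms
  by (simp add: expected_utility_raw_bid)

section \<open>Best response and participation\<close>

text \<open>The closed form is a probability, which spares an estimate of logarithms.\<close>

lemma prem_cdf_le_1:
  assumes "z \<in> {0..1/2}"
  shows "prem_cdf p z \<le> 1"
proof -
  interpret prob_space "rival_law \<tau> p" by (rule prob_space_rival_law[OF p \<tau>])
  show ?thesis using measure_prem_value_le[OF assms] by (metis prob_le_1)
qed

text \<open>Bids below \<open>p\<close> and the bid 1 never yield positive utility, so
  \<open>b\<close> lies in \<open>[p, 1)\<close>. There it is either some raw bid, handled by
  single-peakedness, or above all of them.\<close>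

lemma raw_bid_better_than_positive:
  assumes b: "b \<in> {0..1}" and v: "v \<in> {0..1/2}" and "vd + v \<le> 1"
    and pos: "0 < expected_utility \<tau> p (opt_bid p) vd v b"
  shows "raw_bid p v < 1"
    and "expected_utility \<tau> p (opt_bid p) vd v b \<le> expected_utility \<tau> p (opt_bid p) vd v (raw_bid p v)"
proof -
  have "b \<noteq> 1" using pos assms by (auto simp: expected_utility_1)
  moreover have "\<not> b < p" using pos b by (auto simp: expected_utility_below)
  ultimately have b1: "p \<le> b" "b < 1" using b by auto
  have le: "raw_bid p v \<le> raw_bid p (1/2)"
    using raw_bid_less_iff[OF p, of "1/2" v] v by auto
  show less: "raw_bid p v < 1"
  proof (rule ccontr)
    assume "\<not> raw_bid p v < 1"
    then have "b \<le> raw_bid p (1/2)" and "1 \<le> raw_bid p (1/2)"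
      using le b1 by auto
    obtain z where z: "z \<in> {0..1/2}" "raw_bid p z = b"
      using raw_bid_attains[OF p b1(1)] \<open>b \<le> raw_bid p (1/2)\<close> by blast
    \<comment> \<open>\<open>z'\<close> is the premium value at which the raw bid reaches the cap.
      It lies between \<open>z\<close> and \<open>v\<close>, so the payoff at \<open>z'\<close>
      bounds that at \<open>z\<close>. Only the payoff formula is used at \<open>z'\<close>, since
      there it need not be the utility of the bid 1.\<close>
    obtain z' where z': "z' \<in> {0..1/2}" "raw_bid p z' = 1"
      using raw_bid_attains[OF p, of 1] \<open>1 \<le> raw_bid p (1/2)\<close> p by auto
    have "z < z'" using raw_bid_less_iff[OF p, of z z'] z z' b1 by simp
    moreover have "z' \<le> v" using raw_bid_less_iff[OF p, of v z'] z' v \<open>\<not> raw_bid p v < 1\<close> by auto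
    ultimately have "v * prem_cdf p z - raw_bid p z \<le> v * prem_cdf p z' - raw_bid p z'"
      using z z' by (intro payoff_mono[OF p]) auto
    also have "\<dots> \<le> v - 1"
      using prem_cdf_le_1[OF z'(1)] v z' by (simp add: mult_left_le)
    finally have "expected_utility \<tau> p (opt_bid p) vd v b \<le> vd + v - 1"
      using expected_utility_raw_bid[OF z(1)] z(2) b1 by auto
    then show False using pos assms by simp
  qed
  show "expected_utility \<tau> p (opt_bid p) vd v b \<le> expected_utility \<tau> p (opt_bid p) vd v (raw_bid p v)"
  proof (cases "b \<le> raw_bid p (1/2)")
    case True
    then obtain z where "z \<in> {0..1/2}" "raw_bid p z = b"
      using raw_bid_attains[OF p] b1 by metis
    then show ?thesis
      using expected_utility_le_raw_bid v less b1 by blast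
  next
    case False
    then have "expected_utility \<tau> p (opt_bid p) vd v b = vd + v - b"
      using b1 by (intro expected_utility_above) auto
    \<comment> \<open>As \<open>prem_cdf p (1/2) = 1\<close>, the cheaper bid
      \<open>raw_bid p (1/2)\<close> already wins almost surely.\<close>
    also have "\<dots> \<le> vd + v * prem_cdf p (1/2) - raw_bid p (1/2)"
      using False p by (simp add: prem_cdf_def)
    also have "\<dots> = expected_utility \<tau> p (opt_bid p) vd v (raw_bid p (1/2))"
      using False b1 by (subst expected_utility_raw_bid) auto
    also have "\<dots> \<le> expected_utility \<tau> p (opt_bid p) vd v (raw_bid p v)"
      using v less False b1 by (intro expected_utility_le_raw_bid) auto
    finally show ?thesis .
  qed
qed

lemma opt_bid_range:
  assumes "t \<in> type_space"
  shows "opt_bid p t \<in> {p..1}"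
  using raw_bid_ge[OF p type_space_values(1)[OF assms]] p by (auto simp: opt_bid_def)

text \<open>The positive bid witnessing participation shows that the cap is inactive and that the
  optimal bid has positive utility. A competing bid then loses by comparison if its utility is
  positive, and by sign otherwise.\<close>

lemma participates_opt_bid:
  assumes t: "t \<in> type_space" and "participates \<tau> p (opt_bid p) t"
  defines "u \<equiv> expected_utility \<tau> p (opt_bid p) (dep_value t) (prem_value t)"
  shows "opt_bid p t = raw_bid p (prem_value t)" "opt_bid p t < 1"
    and "0 < u (opt_bid p t)"
    and "b \<in> {0..1} \<Longrightarrow> u b \<le> u (opt_bid p t)"
proof -
  note v = type_space_values[OF t]
  obtain b0 where b0: "b0 \<in> {0..1}" "0 < u b0"
    using assms(2) by (auto simp: participates_def u_def)
  note best = raw_bid_better_than_positive[OF _ v, folded u_def]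
  have less: "raw_bid p (prem_value t) < 1" using best(1)[OF b0] .
  then show opt: "opt_bid p t = raw_bid p (prem_value t)" and "opt_bid p t < 1"
    by (auto simp: opt_bid_def)
  have "u b0 \<le> u (opt_bid p t)" using best(2)[OF b0] opt by simp
  with b0 show pos: "0 < u (opt_bid p t)" by simp
  show "u b \<le> u (opt_bid p t)" if "b \<in> {0..1}"
    using best(2)[OF that] opt pos by (cases "0 < u b") auto
qed

lemma expected_utility_opt_bid:
  assumes t: "t \<in> type_space" and part: "participates \<tau> p (opt_bid p) t"
  shows "expected_utility \<tau> p (opt_bid p) (dep_value t) (prem_value t) (opt_bid p t) = opt_utility p t"
proof -
  note opt = participates_opt_bid(1,2)[OF t part]
  have "expected_utility \<tau> p (opt_bid p) (dep_value t) (prem_value t) (opt_bid p t)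
      = dep_value t + prem_value t * prem_cdf p (prem_value t) - opt_bid p t"
    using expected_utility_raw_bid[OF type_space_values(1)[OF t]] opt by simp
  also have "\<dots> = opt_utility p t"
    by (simp add: opt_utility_def Let_def prem_cdf_def power2_eq_square algebra_simps)
  finally show ?thesis .
qed

lemma symmetric_equilibrium_opt_bid: "symmetric_equilibrium \<tau> p (opt_bid p)"
  using participates_opt_bid(4) opt_bid_range p
  by (fastforce simp: symmetric_equilibrium_def)

text \<open>Strictness needs a positive premium value: at premium value 0 the raw bid is exactly
  \<open>p\<close>.\<close>

lemma opt_bid_gt:
  assumes "t \<in> type_space" "participates \<tau> p (opt_bid p) t" "0 < prem_value t"
  shows "p < opt_bid p t"
  using raw_bid_strict_mono[OF p, of 0 "prem_value t"] raw_bid_0[OF p] assms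
    type_space_values[OF assms(1)] participates_opt_bid(1)[OF assms(1,2)] by simp

end

theorem corollary1:
  fixes M :: "real \<Rightarrow> real" and \<epsilon> p \<tau> :: real
  assumes "M \<in> {0<..<1} \<rightarrow> {0<..<1}"
    and "strict_mono_on {0<..<1} M"
    and "\<epsilon> \<in> {0<..<1}"
    and "p = M \<epsilon>"
    and "\<tau> \<in> {0..1}"
  shows "symmetric_equilibrium \<tau> p (opt_bid p) \<and>
    (\<forall>t\<in>type_space. participates \<tau> p (opt_bid p) t \<longrightarrow>
       expected_utility \<tau> p (opt_bid p) (dep_value t) (prem_value t) (opt_bid p t)
         = opt_utility p t) \<and>
    (\<forall>t\<in>type_space. participates \<tau> p (opt_bid p) t \<longrightarrow>
       0 < expected_utility \<tau> p (opt_bid p) (dep_value t) (prem_value t) (opt_bid p t) \<and>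
       opt_bid p t \<in> {p..<1} \<and>
       (opt_bid p t \<in> M ` {0<..<1} \<longrightarrow>
          compliance M \<tau> p (opt_bid p) t = the_inv_into {0<..<1} M (opt_bid p t) \<and>
          compliance M \<tau> p (opt_bid p) t \<ge> \<epsilon> \<and>
          (0 < prem_value t \<longrightarrow> compliance M \<tau> p (opt_bid p) t > \<epsilon>))) \<and>
    (\<forall>t\<in>type_space. \<not> participates \<tau> p (opt_bid p) t \<longrightarrow>
       compliance M \<tau> p (opt_bid p) t = 0)"
proof (intro conjI ballI impI)
  have p: "0 < p" "p < 1" and \<tau>: "0 \<le> \<tau>" "\<tau> \<le> 1"
    using assms by (auto simp: Pi_iff)
  show "symmetric_equilibrium \<tau> p (opt_bid p)"
    by (rule symmetric_equilibrium_opt_bid[OF p \<tau>])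
  fix t assume t: "t \<in> type_space"
  note range = opt_bid_range[OF p \<tau> t]
  \<comment> \<open>The bid lies in \<open>[0, 1]\<close>, so positive utility from it would itself
    witness participation.\<close>
  show "compliance M \<tau> p (opt_bid p) t = 0" if "\<not> participates \<tau> p (opt_bid p) t"
    using that range p by (auto simp: compliance_def participates_def)
  assume part: "participates \<tau> p (opt_bid p) t"
  show "expected_utility \<tau> p (opt_bid p) (dep_value t) (prem_value t) (opt_bid p t) = opt_utility p t"
    by (rule expected_utility_opt_bid[OF p \<tau> t part])
  show pos: "0 < expected_utility \<tau> p (opt_bid p) (dep_value t) (prem_value t) (opt_bid p t)"
    by (rule participates_opt_bid(3)[OF p \<tau> t part])
  show "opt_bid p t \<in> {p..<1}"
    using range participates_opt_bid(2)[OF p \<tau> t part] by simp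
  \<comment> \<open>\<open>M\<close> may jump, so a bid in \<open>[p, 1)\<close> can miss its range;
    the inverse is evaluated only at attained bids.\<close>
  assume "opt_bid p t \<in> M ` {0<..<1}"
  then obtain s where s: "s \<in> {0<..<1}" "opt_bid p t = M s" by blast
  have comp: "compliance M \<tau> p (opt_bid p) t = the_inv_into {0<..<1} M (opt_bid p t)"
    using pos by (simp add: compliance_def)
  then show "compliance M \<tau> p (opt_bid p) t = the_inv_into {0<..<1} M (opt_bid p t)" .
  have "compliance M \<tau> p (opt_bid p) t = s"
    unfolding comp s(2) by (rule the_inv_into_f_f[OF strict_mono_on_imp_inj_on]) (use assms s in auto)
  moreover have "M \<epsilon> \<le> M s" using range s assms(4) by simp
  ultimately show "\<epsilon> \<le> compliance M \<tau> p (opt_bid p) t"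
    using strict_mono_onD[OF assms(2), of s \<epsilon>] s assms(3) by (auto simp: not_less[symmetric])
  assume "0 < prem_value t"
  then have "M \<epsilon> < M s" using opt_bid_gt[OF p \<tau> t part] s assms(4) by simp
  then show "\<epsilon> < compliance M \<tau> p (opt_bid p) t"
    using strict_mono_onD[OF assms(2), of s \<epsilon>] s assms(3) \<open>compliance M \<tau> p (opt_bid p) t = s\<close>
    by (cases s \<epsilon> rule: linorder_cases) auto
qed

end
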